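(* If $x = 28 = 2^2 \cdot 7$ or $x = 40 = 2^3 \cdot 5$ in $M_{4,6}$, then $\ell_0^M(x^n) \in \Theta(n^{1/2})$ as a function of $n \ge 1$.
   Context: $M_{4,6} = \{1\} \cup \{n \in \mathbb{Z}_{\ge 1} : n \equiv 4 \bmod 6\}$, a multiplicative submonoid of $\mathbb{Z}_{\ge 1}$ (an arithmetical congruence monoid). An atom of $M_{4,6}$ is an irreducible element: an element $u \ne 1$ of $M_{4,6}$ that is not a product of two elements of $M_{4,6} \setminus \{1\}$. For $x \in M_{4,6}$, the set of factorization tuples of $x$ is $\mathsf{Z}(x) = \{\mathbf{z} \in \mathbb{Z}_{\ge 0}^k : x = u_1^{z_1} \cdots u_k^{z_k} \text{ for some } k \ge 0 \text{ and distinct atoms } u_1, \ldots, u_k \in M_{4,6}\}$. For a tuple $\mathbf{z} = (z_1, \ldots, z_k)$, let $\ell_0(\mathbf{z})$ be the number of nonzero entries of $\mathbf{z}$ (i.e. $z_1^0 + \cdots + z_k^0$ with the convention $0^0 = 0$). Let $\ell_0^M(x) = \max\{\ell_0(\mathbf{z}) : \mathbf{z} \in \mathsf{Z}(x)\}$, i.e. the maximum number of distinct atoms occurring in a factorization of $x$ (the superscript $M$ stands for maximum and is not an exponent). *)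

theory Defs
  imports Complex_Main "HOL-Library.Landau_Symbols"
begin

definition M46 :: "nat set" where
  "M46 = {1} \<union> {n. n \<ge> 1 \<and> n mod 6 = 4}"

definition atoms :: "nat set" where
  "atoms = {u \<in> M46. u \<noteq> 1 \<and> \<not> (\<exists>a \<in> M46 - {1}. \<exists>b \<in> M46 - {1}. u = a * b)}"

text \<open>A tuple of arbitrary length \<open>k \<ge> 0\<close> is a list; zero entries are allowed.\<close>

definition Z :: "nat \<Rightarrow> nat list set" where
  "Z x = {z. \<exists>us. length us = length z \<and> distinct us \<and> set us \<subseteq> atoms
              \<and> x = (\<Prod>i<length z. (us ! i) ^ (z ! i))}"

definition l0 :: "nat list \<Rightarrow> nat" where
  "l0 z = card {i. i < length z \<and> z ! i \<noteq> 0}"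

text \<open>Although \<open>Z x\<close> is infinite (tuples may be padded with zeros), the set of values of
  \<open>l0\<close> on it is finite and, for \<open>x\<close> in the monoid, nonempty (shown below), so
  \<^const>\<open>Max\<close> is a genuine maximum.\<close>

definition l0M :: "nat \<Rightarrow> nat" where
  "l0M x = Max (l0 ` Z x)"

lemma l0_less:
  assumes "z \<in> Z x"
  shows "l0 z < x"
proof -
  obtain us where us: "length us = length z" "set us \<subseteq> atoms"
    and x: "x = (\<Prod>i<length z. (us ! i) ^ (z ! i))"
    using assms by (auto simp: Z_def)
  let ?S = "{i. i < length z \<and> z ! i \<noteq> 0}"
  have ge2: "us ! i \<ge> 2" if "i < length z" for i
  proof -
    have "us ! i \<in> atoms" using us that by (metis nth_mem subsetD)
    then show ?thesis by (auto simp: atoms_def M46_def)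
  qed
  have "2 ^ l0 z = (\<Prod>i\<in>?S. (2::nat))" by (simp add: l0_def)
  also have "\<dots> \<le> (\<Prod>i\<in>?S. (us ! i) ^ (z ! i))"
  proof (rule prod_mono)
    fix i assume "i \<in> ?S"
    then show "0 \<le> (2::nat) \<and> 2 \<le> (us ! i) ^ (z ! i)"
      using ge2[of i] self_le_power[of "us ! i" "z ! i"] by auto
  qed
  also have "\<dots> = x"
    unfolding x by (rule prod.mono_neutral_left) auto
  finally show ?thesis using less_exp[of "l0 z"] by linarith
qed

lemma finite_l0_Z: "finite (l0 ` Z x)"
  by (rule finite_subset[of _ "{..<x}"]) (auto dest: l0_less)

lemma Z_mult_atom:
  assumes "z \<in> Z x" and u: "u \<in> atoms"
  shows "Z (u * x) \<noteq> {}"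
proof -
  obtain us where us: "length us = length z" "distinct us" "set us \<subseteq> atoms"
    and x: "x = (\<Prod>i<length z. (us ! i) ^ (z ! i))"
    using assms by (auto simp: Z_def)
  show ?thesis
  proof (cases "u \<in> set us")
    case True
    then obtain j where j: "j < length z" "us ! j = u" by (metis in_set_conv_nth us(1))
    let ?z = "z[j := Suc (z ! j)]"
    have "(\<Prod>i<length z. (us ! i) ^ (?z ! i))
        = u ^ Suc (z ! j) * (\<Prod>i\<in>{..<length z} - {j}. (us ! i) ^ (z ! i))"
      using j by (subst prod.remove[of _ j]) (auto intro!: prod.cong)
    also have "\<dots> = u * x"
      unfolding x using j by (simp add: prod.remove[of _ j])
    finally have "?z \<in> Z (u * x)"
      using us by (auto simp: Z_def intro!: exI[of _ us])
    then show ?thesis by blast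
  next
    case False
    have "u * x = (\<Prod>i<length (1 # z). ((u # us) ! i) ^ ((1 # z) ! i))"
      unfolding x list.size(4) add_Suc_right add_0_right
      by (subst prod.lessThan_Suc_shift) simp
    then have "1 # z \<in> Z (u * x)"
      using us u False unfolding Z_def by (intro CollectI exI[of _ "u # us"]) auto
    then show ?thesis by blast
  qed
qed

lemma Z_nonempty:
  assumes "x \<in> M46"
  shows "Z x \<noteq> {}"
proof -
  have "y \<in> M46 \<Longrightarrow> Z x \<noteq> {} \<Longrightarrow> Z (y * x) \<noteq> {}" for y x
  proof (induction y arbitrary: x rule: less_induct)
    case (less y)
    consider "y = 1" | "y \<in> atoms"
      | a b where "a \<in> M46 - {1}" "b \<in> M46 - {1}" "y = a * b"
      using less.prems(1) by (auto simp: atoms_def)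
    then show ?case
    proof cases
      case 1
      then show ?thesis using less.prems(2) by simp
    next
      case 2
      then show ?thesis using less.prems(2) Z_mult_atom by blast
    next
      case (3 a b)
      have "a \<ge> 2" "b \<ge> 2" using 3 by (auto simp: M46_def)
      then have "a < y" "b < y" using 3 by auto
      then have "Z (a * (b * x)) \<noteq> {}" using 3 less by blast
      then show ?thesis using 3 by (simp add: mult.assoc)
    qed
  qed
  moreover have "[] \<in> Z 1" by (simp add: Z_def)
  ultimately show ?thesis using assms by (metis empty_iff mult.right_neutral)
qed

end

(* Every atom is divisible by 2 but not by 8. Hence the atoms dividing a power of 28 have the form
   4 * 7^b, and those dividing a power of 40 are 4 and numbers 2 * 5^b with b odd. Either way such
   an atom is determined by its exponent b at the odd prime p. In a factorization of x^n these
   exponents add up to n, so k distinct atoms force 0 + 1 + ... + (k - 1) <= n.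
   Conversely, the k atoms with smallest positive b use up at most k^2 of the exponent of p; the
   rest is filled with copies of the atom with b = 1, and the missing powers of 2 with copies of 4. *)
theory Submission
  imports Defs "HOL-Computational_Algebra.Primes"
begin

section \<open>From tuples to finite sets of atoms with exponents\<close>

text \<open>Any enumeration of \<open>A\<close> turns \<open>e\<close> into a tuple in
  \<open>Z y\<close>. Exponents may vanish here, so only atoms that really occur are
  counted.\<close>

lemma l0M_ge:
  assumes "finite A" "A \<subseteq> atoms" "y = (\<Prod>u\<in>A. u ^ e u)"
  shows "card {u \<in> A. e u \<noteq> 0} \<le> l0M y"
proof -
  obtain us where us: "set us = A" "distinct us"
    using finite_distinct_list[OF assms(1)] by blast
  let ?z = "map e us"
  have bij: "bij_betw ((!) us) {..<length us} A"
    using us bij_betw_nth by blast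
  have "(\<Prod>i<length ?z. (us ! i) ^ (?z ! i)) = (\<Prod>i<length us. (us ! i) ^ e (us ! i))"
    by (intro prod.cong) auto
  also have "\<dots> = y"
    unfolding assms(3) by (rule prod.reindex_bij_betw[OF bij])
  finally have "?z \<in> Z y"
    using us assms(2) unfolding Z_def by (intro CollectI exI[of _ us]) auto
  then have "l0 ?z \<le> l0M y"
    unfolding l0M_def by (intro Max_ge finite_l0_Z) auto
  moreover have "(!) us ` {i. i < length ?z \<and> ?z ! i \<noteq> 0} = {u \<in> A. e u \<noteq> 0}"
    using us by (force simp: in_set_conv_nth)
  then have "card {u \<in> A. e u \<noteq> 0} \<le> l0 ?z"
    unfolding l0_def using card_image_le[of "{i. i < length ?z \<and> ?z ! i \<noteq> 0}" "(!) us"] by simp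
  ultimately show ?thesis by linarith
qed

text \<open>A maximizing tuple exists since \<open>Z y\<close> is nonempty and takes finitely many
  values of \<open>l0\<close>. Its zero entries are dropped, and inverting the injective index map
  turns positions into atoms.\<close>

lemma l0M_attained:
  assumes "y \<in> M46"
  obtains A e where "finite A" "A \<subseteq> atoms" "\<And>u. u \<in> A \<Longrightarrow> e u \<noteq> (0::nat)"
    "y = (\<Prod>u\<in>A. u ^ e u)" "card A = l0M y"
proof -
  have "l0M y \<in> l0 ` Z y"
    unfolding l0M_def using Z_nonempty[OF assms] by (intro Max_in finite_l0_Z) auto
  then obtain z us where z: "l0M y = l0 z" and us: "length us = length z" "distinct us"
      "set us \<subseteq> atoms" and y: "y = (\<Prod>i<length z. (us ! i) ^ (z ! i))"
    by (auto simp: Z_def)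
  define I where "I = {i. i < length z \<and> z ! i \<noteq> 0}"
  define e where "e u = z ! the_inv_into I ((!) us) u" for u
  have inj: "inj_on ((!) us) I"
    using us by (auto simp: I_def inj_on_def nth_eq_iff_index_eq)
  have e: "e (us ! i) = z ! i" if "i \<in> I" for i
    using that inj by (simp add: e_def the_inv_into_f_f)
  show ?thesis
  proof (rule that[of "(!) us ` I" e])
    have "y = (\<Prod>i\<in>I. (us ! i) ^ (z ! i))"
      unfolding y by (rule prod.mono_neutral_right) (auto simp: I_def)
    then show "y = (\<Prod>u\<in>(!) us ` I. u ^ e u)"
      using e by (simp add: prod.reindex[OF inj])
    show "card ((!) us ` I) = l0M y"
      using card_image[OF inj] by (simp add: z l0_def I_def)
    show "(!) us ` I \<subseteq> atoms"
      using us by (auto simp: I_def)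
  qed (auto simp: e I_def)
qed

text \<open>Serves the lower bounds: the atoms of \<open>S\<close> are the distinct ones to be
  counted, while powers of \<open>v\<close> and \<open>w\<close> fill up the product.\<close>

lemma l0M_ge_card:
  assumes "finite S" "S \<subseteq> atoms" "v \<in> atoms" "w \<in> atoms"
  shows "card S \<le> l0M (v ^ r * w ^ t * \<Prod>S)"
proof -
  let ?A = "insert v (insert w S)"
  \<comment> \<open>The three contributions are added because \<open>v\<close> and \<open>w\<close>
    may coincide with each other or lie in \<open>S\<close>.\<close>
  define e :: "nat \<Rightarrow> nat"
    where "e u = (if u = v then r else 0) + (if u = w then t else 0) + (if u \<in> S then 1 else 0)" for u
  have "u ^ e u = (if u = v then v ^ r else 1) * (if u = w then w ^ t else 1) * (if u \<in> S then u else 1)"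
    for u by (simp add: e_def power_add)
  then have "(\<Prod>u\<in>?A. u ^ e u) = v ^ r * w ^ t * (\<Prod>u\<in>?A. if u \<in> S then u else 1)"
    using assms(1) by (simp only: prod.distrib prod.delta finite_insert) simp
  also have "(\<Prod>u\<in>?A. if u \<in> S then u else 1) = \<Prod>S"
    using assms(1) by (intro prod.mono_neutral_cong_right) auto
  finally have "card {u \<in> ?A. e u \<noteq> 0} \<le> l0M (v ^ r * w ^ t * \<Prod>S)"
    using assms by (intro l0M_ge) auto
  moreover have "card S \<le> card {u \<in> ?A. e u \<noteq> 0}"
    using assms(1) by (intro card_mono) (auto simp: e_def)
  ultimately show ?thesis by linarith
qed

section \<open>Congruences modulo 3 and the shape of the atoms\<close>

lemma mod_6_eq_4_iff: "n mod 6 = 4 \<longleftrightarrow> even n \<and> n mod 3 = 1" for n :: nat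
proof -
  have "n mod 6 \<in> {0, 1, 2, 3, 4, 5}"
    using mod_less_divisor[of 6 n] by (simp, linarith)
  moreover have "n mod 6 mod 2 = n mod 2" "n mod 6 mod 3 = n mod 3"
    by (simp_all add: mod_mod_cancel)
  ultimately show ?thesis
    unfolding even_iff_mod_2_eq_zero by auto
qed

lemma M46_iff: "n \<in> M46 \<longleftrightarrow> n = 1 \<or> even n \<and> n mod 3 = 1"
  by (cases "n = 0") (auto simp: M46_def mod_6_eq_4_iff)

lemma atomsD: "u \<in> atoms \<Longrightarrow> even u \<and> u mod 3 = 1"
  by (auto simp: atoms_def M46_iff)

lemma atomsI:
  assumes "even u" "u mod 3 = 1"
    and "\<And>c d. even c \<Longrightarrow> c mod 3 = 1 \<Longrightarrow> even d \<Longrightarrow> u = c * d \<Longrightarrow> False"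
  shows "u \<in> atoms"
proof -
  have "u \<in> M46" "u \<noteq> 1" using assms(1,2) by (auto simp: M46_iff)
  moreover have "\<not> (\<exists>a\<in>M46 - {1}. \<exists>b\<in>M46 - {1}. u = a * b)"
  proof (intro notI, elim bexE)
    fix a b assume "a \<in> M46 - {1}" "b \<in> M46 - {1}" "u = a * b"
    then show False using assms(3)[of a b] unfolding Diff_iff M46_iff by blast
  qed
  ultimately show ?thesis unfolding atoms_def by blast
qed

lemma not_atom_mult:
  assumes "even a" "a mod 3 = 1" "even b" "b mod 3 = 1"
  shows "a * b \<notin> atoms"
proof -
  have "a \<in> M46 - {1}" "b \<in> M46 - {1}" using assms by (auto simp: M46_iff)
  then show ?thesis unfolding atoms_def by blast
qed

text \<open>Since 4 is 1 modulo 3, splitting off a factor 4 leaves the residue modulo 3 unchanged; a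
  multiple of 8 stays even as well, so both factors lie in the monoid.\<close>

lemma atom_not_8_dvd:
  assumes "u \<in> atoms"
  shows "\<not> 8 dvd u"
proof
  assume "8 dvd u"
  then obtain c where c: "u = 4 * (2 * c)" by (auto elim!: dvdE)
  then have "(2 * c) mod 3 = 1" using atomsD[OF assms] by presburger
  then show False using not_atom_mult[of 4 "2 * c"] assms c by simp
qed

lemma seven_power_mod_3: "(7::nat) ^ b mod 3 = 1"
  using power_mod[of "7::nat" 3 b] by simp

lemma five_power_mod_3: "(5::nat) ^ b mod 3 = (if even b then 1 else 2)"
proof (induction b)
  case (Suc b)
  have "(5::nat) ^ Suc b mod 3 = (5 * (5 ^ b mod 3)) mod 3"
    by (simp add: mod_mult_right_eq)
  then show ?case using Suc by auto
qed simp

text \<open>Two even factors would each carry exactly one 2. A factor \<open>2 * 7 ^ i\<close> is 2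
  modulo 3 and hence outside the monoid.\<close>

lemma atom_4_times_7_power: "4 * 7 ^ b \<in> atoms"
proof (rule atomsI)
  show "(4 * 7 ^ b :: nat) mod 3 = 1"
    unfolding mod_mult_right_eq[of 4 "7 ^ b" 3, symmetric] seven_power_mod_3 by simp
next
  fix c d :: nat
  assume cd: "even c" "c mod 3 = 1" "even d" "4 * 7 ^ b = c * d"
  obtain c' d' where c': "c = 2 * c'" "d = 2 * d'" using cd by (auto elim!: evenE)
  then have "c' dvd 7 ^ b" using cd by simp
  then obtain i where "c' = 7 ^ i"
    using divides_primepow_nat[of 7 c' b] by auto
  then show False
    using cd(2) c' mod_mult_right_eq[of "2::nat" "7 ^ i" 3] by (simp add: seven_power_mod_3)
qed simp

text \<open>A single factor 2 cannot be shared by two even factors. Odd \<open>b\<close> makes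
  \<open>5 ^ b\<close> equal to 2 modulo 3, which puts the product in the monoid.\<close>

lemma atom_2_times_5_power:
  assumes "odd b"
  shows "2 * 5 ^ b \<in> atoms"
proof (rule atomsI)
  show "(2 * 5 ^ b :: nat) mod 3 = 1"
    unfolding mod_mult_right_eq[of 2 "5 ^ b" 3, symmetric] five_power_mod_3 using assms by simp
next
  fix c d :: nat
  assume "even c" "even d" and eq: "2 * 5 ^ b = c * d"
  then have "2 * 2 dvd c * d" by (intro mult_dvd_mono)
  then have "2 * 2 dvd 2 * (5 ^ b :: nat)" unfolding eq .
  then have "even (5 ^ b :: nat)" using nat_mult_dvd_cancel_disj[of 2 2 "5 ^ b"] by simp
  then show False by simp
qed simp

lemma atom_dvd_2_power_times_prime_power:
  assumes "prime p" "u dvd 2 ^ i * p ^ j" "u \<in> atoms"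
  obtains a b where "u = 2 ^ a * p ^ b" "a \<le> 2"
proof -
  obtain c d where cd: "u = c * d" "c dvd 2 ^ i" "d dvd p ^ j"
    using division_decomp[OF assms(2)] by auto
  then obtain a b where "u = 2 ^ a * p ^ b"
    using divides_primepow_nat[OF two_is_prime_nat] divides_primepow_nat[OF assms(1)] by metis
  moreover have "a \<le> 2"
  proof (rule ccontr)
    assume "\<not> a \<le> 2"
    then have "(2::nat) ^ 3 dvd 2 ^ a" by (intro le_imp_power_dvd) simp
    then show False using atom_not_8_dvd[OF assms(3)] calculation by (simp add: dvd_mult2)
  qed
  ultimately show ?thesis by (rule that)
qed

text \<open>Powers of 7 are 1 modulo 3, so \<open>2 ^ a\<close> must be too. This excludes
  \<open>a = 1\<close>, and parity excludes \<open>a = 0\<close>.\<close>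

lemma atom_2_7D:
  assumes "u \<in> atoms" "u = 2 ^ a * 7 ^ b" "a \<le> 2"
  shows "u = 4 * 7 ^ b"
proof -
  have "(2 ^ a * (7 ^ b mod 3)) mod 3 = (1 :: nat)"
    using atomsD[OF assms(1)] unfolding assms(2) mod_mult_right_eq by blast
  then have "2 ^ a mod 3 = (1 :: nat)" unfolding seven_power_mod_3 by simp
  moreover have "a \<noteq> 0" using atomsD[OF assms(1)] assms(2) by (cases a) auto
  ultimately have "a = 2" using assms(3) by (cases "a = 1") auto
  then show ?thesis using assms(2) by simp
qed

lemma atom_2_5D:
  assumes "u \<in> atoms" "u = 2 ^ a * 5 ^ b" "a \<le> 2"
  shows "u = (if b = 0 then 4 else 2 * 5 ^ b)"
proof -
  have m: "(2 ^ a * (5 ^ b mod 3)) mod 3 = (1 :: nat)"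
    using atomsD[OF assms(1)] unfolding assms(2) mod_mult_right_eq by blast
  have "a \<noteq> 0" using atomsD[OF assms(1)] assms(2) by (cases a) auto
  then consider "a = 1" | "a = 2" using assms(3) by linarith
  then show ?thesis
  proof cases
    case 1
    then have "b \<noteq> 0" using m by (cases b) auto
    with 1 show ?thesis using assms(2) by simp
  next
    case 2
    have "even b" using m 2 by (auto simp: five_power_mod_3 split: if_splits)
    have "b = 0"
    proof (rule ccontr)
      assume "b \<noteq> 0"
      \<comment> \<open>With \<open>b\<close> even and positive, \<open>b - 1\<close> is odd, so
        both factors lie in the monoid and \<open>u\<close> is reducible.\<close>
      then have "u = (2 * 5) * (2 * 5 ^ (b - 1))"
        using assms(2) 2 by (cases b) auto
      moreover have "(2 * 5 ^ (b - 1) :: nat) mod 3 = 1"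
        unfolding mod_mult_right_eq[of 2 "5 ^ (b - 1)" 3, symmetric] five_power_mod_3
        using \<open>even b\<close> \<open>b \<noteq> 0\<close> by simp
      ultimately show False
        using not_atom_mult[of "2 * 5" "2 * 5 ^ (b - 1)"] assms(1) by simp
    qed
    with 2 show ?thesis using assms(2) by simp
  qed
qed

section \<open>Upper bound from the exponents of the odd prime\<close>

lemma inj_on_multiplicity_atoms:
  assumes "p = 5 \<or> p = 7" "A \<subseteq> atoms" "\<And>u. u \<in> A \<Longrightarrow> u dvd 2 ^ i * p ^ j"
  shows "inj_on (multiplicity p) A"
proof -
  have p: "prime p" using assms(1) by auto
  obtain f where f: "u = f (multiplicity p u)" if "u \<in> A" for u
  proof
    \<comment> \<open>One formula recovers the atom from its exponent for both primes; the exponent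
      0 at 5 is the exceptional atom 4.\<close>
    show "u = (\<lambda>b. if p = 5 \<and> b = 0 then 4 else (if p = 5 then 2 else 4) * p ^ b) (multiplicity p u)"
      if u: "u \<in> A" for u
    proof -
      obtain a b where ab: "u = 2 ^ a * p ^ b" "a \<le> 2"
        using atom_dvd_2_power_times_prime_power[OF p assms(3)[OF u]] assms(2) u by blast
      have "\<not> p dvd 2 ^ a" using p assms(1) by (auto dest: prime_dvd_power)
      then have "multiplicity p u = b"
        unfolding ab using p by (simp add: prime_elem_multiplicity_mult_distrib not_dvd_imp_multiplicity_0)
      then show ?thesis
        using assms(1,2) u ab atom_2_5D[of u a b] atom_2_7D[of u a b] by auto
    qed
  qed
  show ?thesis by (rule inj_onI) (metis f)
qed

text \<open>Induction on the largest element: \<open>b\<close> exceeds every element of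
  \<open>B\<close>, so \<open>B\<close> is contained in \<open>{..<b}\<close> and \<open>b\<close>
  is at least \<open>card B\<close>, the new summand on the left.\<close>

lemma sum_card_le_sum:
  fixes B :: "nat set"
  assumes "finite B"
  shows "(\<Sum>i<card B. i) \<le> \<Sum>B"
  using assms
proof (induction rule: finite_linorder_max_induct)
  case (insert b B)
  then have "card B \<le> b"
    using card_mono[of "{..<b}" B] by auto
  then show ?case using insert by auto
qed simp

lemma l0M_power_upper:
  assumes p: "p = 5 \<or> p = 7" and M: "2 ^ i * p ^ n \<in> M46" and n: "n \<ge> 1"
  shows "(l0M (2 ^ i * p ^ n))\<^sup>2 \<le> 4 * n"
proof -
  have pr: "prime p" using p by auto
  obtain A e where A: "finite A" "A \<subseteq> atoms" "\<And>u. u \<in> A \<Longrightarrow> e u \<noteq> (0::nat)"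
    and y: "2 ^ i * p ^ n = (\<Prod>u\<in>A. u ^ e u)" and card: "card A = l0M (2 ^ i * p ^ n)"
    using l0M_attained[OF M] by metis
  have "0 \<notin> A" using A(2) atomsD[of 0] by auto
  have "u dvd 2 ^ i * p ^ n" if "u \<in> A" for u
    unfolding y using dvd_power[of "e u" u] A(1,3) that by (meson dvd_prodI dvd_trans gr0I)
  then have inj: "inj_on (multiplicity p) A"
    using inj_on_multiplicity_atoms[OF p A(2)] by blast
  have "\<not> p dvd 2 ^ i" using pr p by (auto dest: prime_dvd_power)
  \<comment> \<open>The exponent of \<open>p\<close> is computed on both sides of the factorization;
    \<open>2 ^ i\<close> contributes nothing.\<close>
  then have "n = multiplicity p (2 ^ i * p ^ n)"
    using pr by (simp add: prime_elem_multiplicity_mult_distrib not_dvd_imp_multiplicity_0)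
  also have "\<dots> = (\<Sum>u\<in>A. multiplicity p (u ^ e u))"
    unfolding y using A(1) pr \<open>0 \<notin> A\<close> by (intro prime_elem_multiplicity_prod_distrib) auto
  also have "\<dots> = (\<Sum>u\<in>A. e u * multiplicity p u)"
    using pr \<open>0 \<notin> A\<close>
    by (intro sum.cong refl prime_elem_multiplicity_power_distrib) (auto intro: gr0I)
  also have "\<dots> \<ge> (\<Sum>u\<in>A. multiplicity p u)"
    using A(3) by (intro sum_mono) (auto simp: Suc_le_eq)
  finally have "\<Sum>(multiplicity p ` A) \<le> n"
    by (simp add: sum.reindex[OF inj])
  then have "(\<Sum>i<card A. i) \<le> n"
    using sum_card_le_sum[of "multiplicity p ` A"] A(1) by (simp add: card_image inj)
  \<comment> \<open>Gauss's sum, written without division or truncated subtraction.\<close>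
  moreover have "2 * (\<Sum>i<k. i) + k = k\<^sup>2" for k :: nat
    by (induction k) (auto simp: power2_eq_square)
  ultimately have le: "(card A)\<^sup>2 \<le> 2 * n + card A"
    by (metis add_le_mono1 mult_le_mono2)
  \<comment> \<open>For \<open>card A\<close> at least 2 the linear term is at most half the square
    and is absorbed; the remaining case uses \<open>n \<ge> 1\<close>.\<close>
  have "(card A)\<^sup>2 \<le> 4 * n"
  proof (cases "card A \<le> 1")
    case True
    then have "card A * card A \<le> 1 * 1" by (intro mult_mono) auto
    then show ?thesis using n by (simp add: power2_eq_square)
  next
    case False
    then have "2 * card A \<le> card A * card A" by (intro mult_right_mono) auto
    then show ?thesis using le unfolding power2_eq_square by linarith
  qed
  then show ?thesis using card by simp
qed

section \<open>Lower bound by explicit factorizations\<close>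

lemma l0M_28_power_ge:
  assumes "k\<^sup>2 \<le> n"
  shows "k \<le> l0M (28 ^ n)"
proof -
  define s where "s = (\<Sum>i\<in>{1..k}. i)"
  define S where "S = (\<lambda>i. 4 * 7 ^ i :: nat) ` {1..k}"
  have inj: "inj_on (\<lambda>i. 4 * 7 ^ i :: nat) {1..k}" by (auto simp: inj_on_def)
  have "s \<le> k\<^sup>2"
    unfolding s_def using sum_bounded_above[of "{1..k}" "\<lambda>i. i" k] by (simp add: power2_eq_square)
  with assms have sn: "s \<le> n" by linarith
  \<comment> \<open>Because the exponents start at 1, the difference in \<open>4 ^ (s - k)\<close>
    does not truncate.\<close>
  have ks: "k \<le> s"
    unfolding s_def using sum_bounded_below[of "{1..k}" 1 "\<lambda>i. i"] by simp
  have "\<Prod>S = 4 ^ k * 7 ^ s"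
    unfolding S_def s_def prod.reindex[OF inj] by (simp add: prod.distrib power_sum)
  \<comment> \<open>Copies of 28 supply the missing \<open>n - s\<close> factors 7; the factors 4
    then number \<open>(s - k) + (n - s) + k = n\<close>.\<close>
  then have "4 ^ (s - k) * 28 ^ (n - s) * \<Prod>S = (4 ^ (s - k) * 4 ^ (n - s) * 4 ^ k) * (7 ^ (n - s) * 7 ^ s)"
    using power_mult_distrib[of "4::nat" 7 "n - s"] by simp
  also have "\<dots> = 28 ^ n"
    using sn ks power_mult_distrib[of "4::nat" 7 n] by (simp flip: power_add)
  finally have "4 ^ (s - k) * 28 ^ (n - s) * \<Prod>S = 28 ^ n" .
  moreover have "card S \<le> l0M (4 ^ (s - k) * 28 ^ (n - s) * \<Prod>S)"
    using atom_4_times_7_power[of 0] atom_4_times_7_power[of 1] atom_4_times_7_power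
    by (intro l0M_ge_card) (auto simp: S_def)
  moreover have "card S = k" unfolding S_def card_image[OF inj] by simp
  ultimately show ?thesis by simp
qed

lemma l0M_40_power_ge:
  assumes "k\<^sup>2 \<le> n"
  shows "k \<le> l0M (40 ^ n)"
proof -
  define S where "S = (\<lambda>i. 2 * 5 ^ (2 * i + 1) :: nat) ` {..<k}"
  have inj: "inj_on (\<lambda>i. 2 * 5 ^ (2 * i + 1) :: nat) {..<k}" by (auto simp: inj_on_def)
  have sum: "(\<Sum>i<k. 2 * i + 1) = k\<^sup>2" by (induction k) (auto simp: power2_eq_square)
  have "k \<le> k\<^sup>2" by (simp add: power2_eq_square)
  \<comment> \<open>The atoms in \<open>S\<close> and the \<open>n - k^2\<close> copies of 10
    contain \<open>k + n - k^2\<close> factors 2 out of the \<open>3 * n\<close> in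
    \<open>40 ^ n\<close>. The deficit is even, as \<open>k^2 - k\<close> is, so copies of 4 can
    fill it.\<close>
  then have "even (2 * n + k\<^sup>2 - k)" by simp
  then obtain r where r: "2 * n + k\<^sup>2 - k = 2 * r" by (elim evenE)
  have "\<Prod>S = (\<Prod>i<k. 2 * 5 ^ (2 * i + 1))"
    unfolding S_def prod.reindex[OF inj] by simp
  also have "\<dots> = 2 ^ k * 5 ^ k\<^sup>2"
    by (simp only: prod.distrib prod_constant card_lessThan sum flip: power_sum)
  finally have "4 ^ r * 10 ^ (n - k\<^sup>2) * \<Prod>S
      = (2 ^ (2 * r) * 2 ^ (n - k\<^sup>2) * 2 ^ k) * (5 ^ (n - k\<^sup>2) * 5 ^ k\<^sup>2)"
    using power_mult_distrib[of "2::nat" 5 "n - k\<^sup>2"] power_mult[of "2::nat" 2 r] by simp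
  also have "\<dots> = 2 ^ (2 * r + (n - k\<^sup>2) + k) * 5 ^ n"
    using assms by (simp flip: power_add)
  also have "2 * r + (n - k\<^sup>2) + k = 3 * n"
    using r assms \<open>k \<le> k\<^sup>2\<close> by linarith
  also have "2 ^ (3 * n) * 5 ^ n = (40 ^ n :: nat)"
    using power_mult_distrib[of "8::nat" 5 n] power_mult[of "2::nat" 3 n] by simp
  finally have "4 ^ r * 10 ^ (n - k\<^sup>2) * \<Prod>S = 40 ^ n" .
  moreover have "card S \<le> l0M (4 ^ r * 10 ^ (n - k\<^sup>2) * \<Prod>S)"
  proof (rule l0M_ge_card)
    show "S \<subseteq> atoms" unfolding S_def by (intro image_subsetI atom_2_times_5_power) simp
  qed (use atom_4_times_7_power[of 0] atom_2_times_5_power[of 1] in \<open>simp_all add: S_def\<close>)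
  moreover have "card S = k" unfolding S_def card_image[OF inj] by simp
  ultimately show ?thesis by simp
qed

section \<open>Passage to the asymptotic statement\<close>

text \<open>Avoids integer square roots: \<open>m + 1\<close> violates the hypothesis, so
  \<open>n < (m + 1)^2\<close>, and \<open>m \<ge> 1\<close> gives
  \<open>m + 1 \<le> 2 * m\<close>.\<close>

lemma le_4_times_square:
  fixes m n :: nat
  assumes "\<And>k. k\<^sup>2 \<le> n \<Longrightarrow> k \<le> m" "n \<ge> 1"
  shows "n \<le> 4 * m\<^sup>2"
proof -
  have "\<not> (Suc m)\<^sup>2 \<le> n" using assms(1)[of "Suc m"] by auto
  moreover have "m \<ge> 1" using assms(1)[of 1] assms(2) by simp
  then have "(Suc m)\<^sup>2 \<le> (2 * m)\<^sup>2" by (intro power_mono) auto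
  ultimately show ?thesis by (simp add: power_mult_distrib)
qed

theorem proposition3p6:
  fixes x :: nat
  assumes "x = 28 \<or> x = 40"
  shows "(\<lambda>n. real (l0M (x ^ n))) \<in> \<Theta>(\<lambda>n. real n powr (1/2))"
proof -
  obtain c p where c: "p = 5 \<or> p = 7" "x = 2 ^ c * p"
    using assms that[of 5 3] that[of 7 2] by auto
  have upper: "(l0M (x ^ n))\<^sup>2 \<le> 4 * n" if n: "n \<ge> 1" for n
  proof -
    \<comment> \<open>Both 28 and 40 are 1 modulo 3.\<close>
    have "x ^ n mod 3 = 1" using assms power_mod[of x 3 n] by auto
    moreover have "even (x ^ n)" using assms n by auto
    moreover have "x ^ n = 2 ^ (c * n) * p ^ n"
      by (simp add: c(2) power_mult_distrib power_mult)
    ultimately show ?thesis using l0M_power_upper[OF c(1) _ n, of "c * n"] by (simp add: M46_iff)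
  qed
  have lower: "n \<le> 4 * (l0M (x ^ n))\<^sup>2" if "n \<ge> 1" for n
    using assms l0M_28_power_ge l0M_40_power_ge that by (intro le_4_times_square) auto
  have "real (l0M (x ^ n)) \<le> 2 * sqrt n" if "n \<ge> 1" for n
  proof -
    have "(real (l0M (x ^ n)))\<^sup>2 \<le> 4 * real n"
      using upper[OF that] by (metis of_nat_le_iff of_nat_mult of_nat_numeral of_nat_power)
    then have "real (l0M (x ^ n)) \<le> sqrt (4 * real n)" by (rule real_le_rsqrt)
    then show ?thesis by (simp add: real_sqrt_mult)
  qed
  moreover have "sqrt n \<le> 2 * real (l0M (x ^ n))" if "n \<ge> 1" for n
  proof -
    have "real n \<le> (2 * real (l0M (x ^ n)))\<^sup>2"
      using lower[OF that] by (simp add: power_mult_distrib) (metis of_nat_le_iff of_nat_mult of_nat_numeral of_nat_power)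
    then show ?thesis by (intro real_le_lsqrt) auto
  qed
  ultimately show ?thesis
    \<comment> \<open>The constants 2 and 1/2 are those of the two square root bounds, valid from
      \<open>n = 1\<close> on.\<close>
    by (intro bigthetaI bigoI[of _ 2] landau_omega.bigI[of "1/2"] eventually_at_top_linorderI[of 1])
       (auto simp: powr_half_sqrt mult.commute)
qed

end
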